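(* Let $m\in\{0,\ldots,M-1\}$ and let $(\mathcal V^{m+1},\varkappa^{m+1},\kappa^{m+1},\vec X^{m+1})$ be a solution of the linear scheme (L1)--(L4) given in the context. Then $$E_{\overline\varkappa}(\vec X^m,\varkappa^{m+1})+2\pi\,\Delta t\,\bigl(\vec X^m\cdot\vec e_1\,(\mathcal V^{m+1})^2,\ |\vec X^m_\rho|\bigr)\ \le\ E_{\overline\varkappa}(\vec X^{m-1},\varkappa^m),$$ for each $m=0,\ldots,M-1$ (with the convention $\vec X^{-1}=\vec X^0$).
   Context: Domain and spaces. Either $\mathbb I=\mathbb R/\mathbb Z$ (with $\partial\mathbb I=\emptyset$) or $\mathbb I=(0,1)$ (with $\partial\mathbb I=\{0,1\}$). $\vec e_1,\vec e_2$ is the standard basis of $\mathbb R^2$; $(\cdot)^\perp$ is clockwise rotation by $\pi/2$; $(\cdot,\cdot)$ is the $L^2$-inner product on $\mathbb I$; $\overline\varkappa\in\mathbb R$ is a given constant. Let $J\in\mathbb N$, $h=1/J$, $\rho_j=jh$, $\mathbb I_j=[\rho_{j-1},\rho_j]$, $j=1,\ldots,J$ (with $\rho_0=\rho_J$ identified if $\mathbb I=\mathbb R/\mathbb Z$). $V^h$ is the space of continuous functions on $\overline{\mathbb I}$ that are affine on each $\mathbb I_j$, and $\underline V_\partial^h=\{\vec\eta\in[V^h]^2:\ \vec\eta(\rho)\cdot\vec e_1=0\ \forall\rho\in\partial\mathbb I\}$. The mass-lumped product is $(u,v)^h=\frac h2\sum_{j=1}^J[(u\cdot v)(\rho_j^-)+(u\cdot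 v)(\rho_{j-1}^+)]$ for piecewise continuous $u,v$ with possible jumps at nodes. $(\cdot,\cdot)^\diamond$ denotes an approximation of $(\cdot,\cdot)$ by an elementwise quadrature rule that is exact for polynomials of degree up to three on each $\mathbb I_j$ and has non-negative weights. Energy: $E_{\overline\varkappa}(\vec X,\varkappa)=\pi\int_{\mathbb I}\vec X\cdot\vec e_1\,(\varkappa-\overline\varkappa)^2\,|\vec X_\rho|\,d\rho$. Time discretization: $\Delta t=T/M$, $t_m=m\Delta t$. Standing assumption: for $m=0,1,\ldots,M$, $\vec X^m\in\underline V_\partial^h$ satisfies $\vec X^m\cdot\vec e_1>0$ in $\overline{\mathbb I}\setminus\partial\mathbb I$ and $|\vec X^m_\rho|>0$ in $\overline{\mathbb I}$. Set $\vec\tau^m=\vec X^m_\rho/|\vec X^m_\rho|$, $\vec\nu^m=-(\vec\tau^m)^\perp$, and $$\mathcal J^m=\frac{\vec X^{m-1}\cdot\vec e_1\,|\vec X^{m-1}_\rho|}{\vec X^m\cdot\vec e_1\,|\vec X^m_\rho|}$$ (at a point of $\partial\mathbb I$, $\mathcal J^m$ is understood by continuous extension from the adjacent element, on which the ratio of the two affine functions $\vec X^{m-1}\cdot\vec e_1$ and $\vec X^m\cdot\vec e_1$, both vanishing at the endpoint, is constant). Linear scheme. Given $\vec X^0\in\underline V_\partial^h$, $\varkappa^0,\kappa^0\in V^h$, set $\vec X^{-1}=\vec X^0$ (so $\mathcal J^0=1$). For $m=0,\ldots,M-1$ find $\mathcal V^{m+1},\varkappa^{m+1},\kappa^{m+1}\in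 V^h$ and $\vec X^{m+1}\in\underline V_\partial^h$ such that (L1) for all $\varphi^h\in V^h$: $(\vec X^m\cdot\vec e_1\,\mathcal V^{m+1},\varphi^h|\vec X^m_\rho|)-(\vec X^m\cdot\vec e_1\,\varkappa^{m+1}_\rho,\varphi^h_\rho|\vec X^m_\rho|^{-1})+2(\vec\nu^m\cdot\vec e_1\,\kappa^m(\varkappa^{m+1}-\overline\varkappa),\varphi^h|\vec X^m_\rho|)+\frac12(\vec X^m\cdot\vec e_1\,(\varkappa^m+\overline\varkappa)\varkappa^m(\varkappa^{m+1}-\overline\varkappa),\varphi^h|\vec X^m_\rho|)=0$; (L2) for all $\chi^h\in V^h$: $\bigl(\vec X^m\cdot\vec e_1\,\frac{\varkappa^{m+1}-\overline\varkappa-(\varkappa^m-\overline\varkappa)\sqrt{\mathcal J^m}}{\Delta t},\chi^h|\vec X^m_\rho|\bigr)^\diamond+(\vec X^m\cdot\vec e_1\,\mathcal V^{m+1}_\rho,\chi^h_\rho|\vec X^m_\rho|^{-1})-2(\vec\nu^m\cdot\vec e_1\,\kappa^m\mathcal V^{m+1},\chi^h|\vec X^m_\rho|)-\frac12(\vec X^m\cdot\vec e_1\,(\varkappa^m+\overline\varkappa)\varkappa^m\mathcal V^{m+1},\chi^h|\vec X^m_\rho|)-\frac12\bigl(\vec X^m\cdot\vec e_1\,\frac{(\vec X^m-\vec X^{m-1})\cdot\vec\tau^m}{\Delta t},\varkappa^{m+1}_\rho\chi^h-(\varkappa^{m+1}-\overline\varkappa)\chi^h_\rho\bigr)=0$;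 (L3) for all $\xi^h\in V^h$: $\bigl(\frac{\vec X^{m+1}-\vec X^m}{\Delta t}\cdot\vec\nu^m,\xi^h|\vec X^m_\rho|\bigr)^h-(\mathcal V^{m+1},\xi^h|\vec X^m_\rho|)=0$; (L4) for all $\vec\eta^h\in\underline V_\partial^h$: $(\kappa^{m+1}\vec\nu^m,\vec\eta^h|\vec X^m_\rho|)^h+(\vec X^{m+1}_\rho,\vec\eta^h_\rho|\vec X^m_\rho|^{-1})=0$. *)

theory Defs
  imports "HOL-Analysis.Analysis" "HOL-Computational_Algebra.Polynomial"
begin

text \<open>
  The parameter domain is the circle \<open>\<real>/\<int>\<close> or the interval \<open>(0,1)\<close>. Functions on its closure are
  total functions on the reals of which only the values on \<open>{0..1}\<close> matter; on the circle the
  values at 0 and 1 agree.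
\<close>

datatype domain = Circle | Open_Interval

fun bdry :: "domain \<Rightarrow> real set" where
  "bdry Circle = {}"
| "bdry Open_Interval = {0, 1}"

definition mesh :: "nat \<Rightarrow> real" where
  "mesh J = 1 / real J"

definition node :: "nat \<Rightarrow> nat \<Rightarrow> real" where
  "node J j = real j * mesh J"

definition element :: "nat \<Rightarrow> nat \<Rightarrow> real set" where
  "element J j = {node J (j - 1)..node J j}"

definition open_element :: "nat \<Rightarrow> nat \<Rightarrow> real set" where
  "open_element J j = {node J (j - 1)<..<node J j}"

definition e1 :: "real^2" where
  "e1 = axis 1 1"

text \<open>Clockwise rotation by \<open>\<pi>/2\<close>.\<close>

definition perp :: "real^2 \<Rightarrow> real^2" where
  "perp v = vector [v $ 2, - (v $ 1)]"

definition Vh :: "domain \<Rightarrow> nat \<Rightarrow> (real \<Rightarrow> real) set" where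
  "Vh D J = {f. continuous_on {0..1} f \<and> (D = Circle \<longrightarrow> f 0 = f 1) \<and>
     (\<forall>j\<in>{1..J}. \<exists>a b. \<forall>\<rho>\<in>element J j. f \<rho> = a + b * \<rho>)}"

definition Vh_bdry :: "domain \<Rightarrow> nat \<Rightarrow> (real \<Rightarrow> real^2) set" where
  "Vh_bdry D J = {\<eta>. (\<forall>i. (\<lambda>\<rho>. \<eta> \<rho> $ i) \<in> Vh D J) \<and> (\<forall>\<rho>\<in>bdry D. \<eta> \<rho> \<bullet> e1 = 0)}"

text \<open>
  The elementwise derivative. At a mesh node, where a piecewise affine function need not be
  differentiable, the value is unspecified; it is never used: integrals ignore the nodes, and
  the discrete products below take one-sided limits there.
\<close>

definition deriv_rho :: "(real \<Rightarrow> 'a::real_normed_vector) \<Rightarrow> real \<Rightarrow> 'a" where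
  "deriv_rho f \<rho> = vector_derivative f (at \<rho>)"

definition speed :: "(real \<Rightarrow> real^2) \<Rightarrow> real \<Rightarrow> real" where
  "speed X \<rho> = norm (deriv_rho X \<rho>)"

definition tangent :: "(real \<Rightarrow> real^2) \<Rightarrow> real \<Rightarrow> real^2" where
  "tangent X \<rho> = deriv_rho X \<rho> /\<^sub>R speed X \<rho>"

definition normal_vec :: "(real \<Rightarrow> real^2) \<Rightarrow> real \<Rightarrow> real^2" where
  "normal_vec X \<rho> = - perp (tangent X \<rho>)"

text \<open>For real-valued functions the inner product below is multiplication.\<close>

definition ip :: "(real \<Rightarrow> 'a::real_inner) \<Rightarrow> (real \<Rightarrow> 'a) \<Rightarrow> real" where
  "ip u v = integral {0..1} (\<lambda>\<rho>. u \<rho> \<bullet> v \<rho>)"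

definition lumped :: "nat \<Rightarrow> (real \<Rightarrow> 'a::real_inner) \<Rightarrow> (real \<Rightarrow> 'a) \<Rightarrow> real" where
  "lumped J u v = mesh J / 2 *
     (\<Sum>j=1..J. Lim (at_left (node J j)) (\<lambda>\<rho>. u \<rho> \<bullet> v \<rho>)
             + Lim (at_right (node J (j - 1))) (\<lambda>\<rho>. u \<rho> \<bullet> v \<rho>))"

text \<open>
  On the element \<open>j\<close> the quadrature rule has the finite set of points \<open>Q j\<close> and the weight \<open>w j p\<close>
  at the point \<open>p\<close>.
\<close>

definition quadrature_rule :: "nat \<Rightarrow> (nat \<Rightarrow> real set) \<Rightarrow> (nat \<Rightarrow> real \<Rightarrow> real) \<Rightarrow> bool" where
  "quadrature_rule J Q w \<longleftrightarrow> (\<forall>j\<in>{1..J}.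
     finite (Q j) \<and> Q j \<subseteq> element J j \<and> (\<forall>p\<in>Q j. w j p \<ge> 0) \<and>
     (\<forall>q :: real poly. degree q \<le> 3 \<longrightarrow>
        (\<Sum>p\<in>Q j. w j p * poly q p) = integral (element J j) (poly q)))"

text \<open>
  A quadrature point may be an endpoint of its element, where the integrand can jump or be a
  quotient 0/0; the integrand is evaluated by continuous extension from the interior of the element.
\<close>

definition diamond ::
  "nat \<Rightarrow> (nat \<Rightarrow> real set) \<Rightarrow> (nat \<Rightarrow> real \<Rightarrow> real) \<Rightarrow>
   (real \<Rightarrow> 'a::real_inner) \<Rightarrow> (real \<Rightarrow> 'a) \<Rightarrow> real" where
  "diamond J Q w u v =
     (\<Sum>j=1..J. \<Sum>p\<in>Q j. w j p * Lim (at p within open_element J j) (\<lambda>\<rho>. u \<rho> \<bullet> v \<rho>))"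

definition energy :: "real \<Rightarrow> (real \<Rightarrow> real^2) \<Rightarrow> (real \<Rightarrow> real) \<Rightarrow> real" where
  "energy c X \<mu> = pi * integral {0..1} (\<lambda>\<rho>. (X \<rho> \<bullet> e1) * (\<mu> \<rho> - c)\<^sup>2 * speed X \<rho>)"

text \<open>Standing assumptions on a discrete curve.\<close>

definition admissible :: "domain \<Rightarrow> nat \<Rightarrow> (real \<Rightarrow> real^2) \<Rightarrow> bool" where
  "admissible D J X \<longleftrightarrow> X \<in> Vh_bdry D J \<and>
     (\<forall>\<rho>\<in>{0..1} - bdry D. X \<rho> \<bullet> e1 > 0) \<and>
     (\<forall>j\<in>{1..J}. \<forall>\<rho>\<in>open_element J j. speed X \<rho> > 0)"

text \<open>The convention \<open>X\<^sup>-\<^sup>1 = X\<^sup>0\<close>.\<close>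

definition prev :: "(nat \<Rightarrow> real \<Rightarrow> real^2) \<Rightarrow> nat \<Rightarrow> real \<Rightarrow> real^2" where
  "prev X m = (if m = 0 then X 0 else X (m - 1))"

definition jac :: "(real \<Rightarrow> real^2) \<Rightarrow> (real \<Rightarrow> real^2) \<Rightarrow> real \<Rightarrow> real" where
  "jac Xp X \<rho> = ((Xp \<rho> \<bullet> e1) * speed Xp \<rho>) / ((X \<rho> \<bullet> e1) * speed X \<rho>)"

text \<open>
  One time step of the linear scheme. The constant \<open>c\<close> is the spontaneous curvature, \<open>dt\<close> the time
  step; \<open>Xp\<close>, \<open>X\<close>, \<open>Xn\<close> are the curves at the time levels \<open>m - 1\<close>, \<open>m\<close>, \<open>m + 1\<close>; \<open>\<mu>\<close>, \<open>\<mu>n\<close> stand for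
  varkappa and \<open>\<kappa>\<close>, \<open>\<kappa>n\<close> for kappa at the levels \<open>m\<close>, \<open>m + 1\<close>; \<open>Vn\<close> is the velocity at level \<open>m + 1\<close>.
\<close>

definition eq_L1 where
  "eq_L1 D J c X \<mu> \<kappa> Vn \<mu>n \<longleftrightarrow> (\<forall>\<phi>\<in>Vh D J.
     ip (\<lambda>\<rho>. (X \<rho> \<bullet> e1) * Vn \<rho>) (\<lambda>\<rho>. \<phi> \<rho> * speed X \<rho>)
     - ip (\<lambda>\<rho>. (X \<rho> \<bullet> e1) * deriv_rho \<mu>n \<rho>) (\<lambda>\<rho>. deriv_rho \<phi> \<rho> * inverse (speed X \<rho>))
     + 2 * ip (\<lambda>\<rho>. (normal_vec X \<rho> \<bullet> e1) * \<kappa> \<rho> * (\<mu>n \<rho> - c)) (\<lambda>\<rho>. \<phi> \<rho> * speed X \<rho>)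
     + 1/2 * ip (\<lambda>\<rho>. (X \<rho> \<bullet> e1) * (\<mu> \<rho> + c) * \<mu> \<rho> * (\<mu>n \<rho> - c)) (\<lambda>\<rho>. \<phi> \<rho> * speed X \<rho>)
     = (0::real))"

definition eq_L2 where
  "eq_L2 D J Q w c dt Xp X \<mu> \<kappa> Vn \<mu>n \<longleftrightarrow> (\<forall>\<zeta>\<in>Vh D J.
     diamond J Q w
       (\<lambda>\<rho>. (X \<rho> \<bullet> e1) * ((\<mu>n \<rho> - c - (\<mu> \<rho> - c) * sqrt (jac Xp X \<rho>)) / dt))
       (\<lambda>\<rho>. \<zeta> \<rho> * speed X \<rho>)
     + ip (\<lambda>\<rho>. (X \<rho> \<bullet> e1) * deriv_rho Vn \<rho>) (\<lambda>\<rho>. deriv_rho \<zeta> \<rho> * inverse (speed X \<rho>))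
     - 2 * ip (\<lambda>\<rho>. (normal_vec X \<rho> \<bullet> e1) * \<kappa> \<rho> * Vn \<rho>) (\<lambda>\<rho>. \<zeta> \<rho> * speed X \<rho>)
     - 1/2 * ip (\<lambda>\<rho>. (X \<rho> \<bullet> e1) * (\<mu> \<rho> + c) * \<mu> \<rho> * Vn \<rho>) (\<lambda>\<rho>. \<zeta> \<rho> * speed X \<rho>)
     - 1/2 * ip (\<lambda>\<rho>. (X \<rho> \<bullet> e1) * (((X \<rho> - Xp \<rho>) \<bullet> tangent X \<rho>) / dt))
                (\<lambda>\<rho>. deriv_rho \<mu>n \<rho> * \<zeta> \<rho> - (\<mu>n \<rho> - c) * deriv_rho \<zeta> \<rho>)
     = (0::real))"

definition eq_L3 where
  "eq_L3 D J dt X Vn Xn \<longleftrightarrow> (\<forall>\<xi>\<in>Vh D J.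
     lumped J (\<lambda>\<rho>. ((Xn \<rho> - X \<rho>) /\<^sub>R dt) \<bullet> normal_vec X \<rho>) (\<lambda>\<rho>. \<xi> \<rho> * speed X \<rho>)
     - ip Vn (\<lambda>\<rho>. \<xi> \<rho> * speed X \<rho>) = (0::real))"

definition eq_L4 where
  "eq_L4 D J X \<kappa>n Xn \<longleftrightarrow> (\<forall>\<eta>\<in>Vh_bdry D J.
     lumped J (\<lambda>\<rho>. \<kappa>n \<rho> *\<^sub>R normal_vec X \<rho>) (\<lambda>\<rho>. speed X \<rho> *\<^sub>R \<eta> \<rho>)
     + ip (deriv_rho Xn) (\<lambda>\<rho>. inverse (speed X \<rho>) *\<^sub>R deriv_rho \<eta> \<rho>) = (0::real))"

definition solves_step ::
  "domain \<Rightarrow> nat \<Rightarrow> (nat \<Rightarrow> real set) \<Rightarrow> (nat \<Rightarrow> real \<Rightarrow> real) \<Rightarrow> real \<Rightarrow> real \<Rightarrow>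
   (real \<Rightarrow> real^2) \<Rightarrow> (real \<Rightarrow> real^2) \<Rightarrow> (real \<Rightarrow> real) \<Rightarrow> (real \<Rightarrow> real) \<Rightarrow>
   (real \<Rightarrow> real) \<Rightarrow> (real \<Rightarrow> real) \<Rightarrow> (real \<Rightarrow> real) \<Rightarrow> (real \<Rightarrow> real^2) \<Rightarrow> bool" where
  "solves_step D J Q w c dt Xp X \<mu> \<kappa> Vn \<mu>n \<kappa>n Xn \<longleftrightarrow>
     Vn \<in> Vh D J \<and> \<mu>n \<in> Vh D J \<and> \<kappa>n \<in> Vh D J \<and> Xn \<in> Vh_bdry D J \<and>
     eq_L1 D J c X \<mu> \<kappa> Vn \<mu>n \<and>
     eq_L2 D J Q w c dt Xp X \<mu> \<kappa> Vn \<mu>n \<and>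
     eq_L3 D J dt X Vn Xn \<and>
     eq_L4 D J X \<kappa>n Xn"

end

theory Submission imports Defs begin

text \<open>
  Testing the first equation with the new velocity and the second with the new deviation
  \<open>\<mu>n - c\<close> makes every coupling term occur twice with opposite signs, and the convective term
  is antisymmetric in its two slots, so it vanishes. What remains is
  \<open>(x V, V s) + (x (a - b \<surd>jac) / dt, a s)\<^sup>\<diamond> = 0\<close>, where \<open>x\<close> is the radial coordinate of the
  curve, \<open>s\<close> its speed, and \<open>a\<close>, \<open>b\<close> are the new and the old curvature deviation.

  Young's inequality \<open>a (a - b \<surd>jac) \<ge> (a\<^sup>2 - b\<^sup>2 jac) / 2\<close> at every quadrature point, together with
  the fact that \<open>jac\<close> turns the weight \<open>x s\<close> into the weight of the previous curve, bounds the
  quadrature term below by \<open>1 / (2 dt)\<close> times the difference of the quadratures of \<open>x a\<^sup>2 s\<close> and of its analogue at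
  the previous level. On each element these densities are polynomials of degree at most three, so the
  quadrature of either is, up to the factor \<open>\<pi>\<close>, exactly an energy. The three parts of the
  argument are \<open>dissipation_eq_diamond\<close> (testing), \<open>energy_eq_quadrature\<close> (exactness) and
  \<open>diamond_ge_energy_difference\<close> (Young).
\<close>

lemma node_mem_unit:
  assumes "j \<in> {1..J}"
  shows "0 \<le> node J (j - 1)" "node J (j - 1) < node J j" "node J j \<le> 1"
  using assms by (auto simp: node_def mesh_def field_simps of_nat_diff)

lemma element_subset_unit:
  assumes "j \<in> {1..J}" "p \<in> element J j"
  shows "p \<in> {0..1}"
  using node_mem_unit[OF assms(1)] assms(2) by (auto simp: element_def)

lemma open_element_subset: "open_element J j \<subseteq> element J j"
  by (auto simp: element_def open_element_def)

lemma Vh_affine: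
  assumes "f \<in> Vh D J" "j \<in> {1..J}"
  obtains a b where "\<And>\<rho>. \<rho> \<in> element J j \<Longrightarrow> f \<rho> = a + b * \<rho>"
proof -
  have "\<exists>a b. \<forall>\<rho>\<in>element J j. f \<rho> = a + b * \<rho>"
    using assms unfolding Vh_def by blast
  then show ?thesis using that by blast
qed

lemma Vh_bdry_affine:
  assumes "X \<in> Vh_bdry D J" "j \<in> {1..J}"
  obtains A B where "\<And>\<rho>. \<rho> \<in> element J j \<Longrightarrow> X \<rho> = A + \<rho> *\<^sub>R B"
proof -
  have "\<exists>a b. \<forall>\<rho>\<in>element J j. X \<rho> $ i = a + b * \<rho>" for i
    using assms by (auto simp: Vh_bdry_def Vh_def)
  then obtain a b where ab: "\<And>i \<rho>. \<rho> \<in> element J j \<Longrightarrow> X \<rho> $ i = a i + b i * \<rho>"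
    by metis
  have "X \<rho> = (\<chi> i. a i) + \<rho> *\<^sub>R (\<chi> i. b i)" if "\<rho> \<in> element J j" for \<rho>
    using ab[OF that] by (simp add: vec_eq_iff mult.commute)
  then show ?thesis using that by blast
qed

lemma Vh_minus_const:
  assumes "f \<in> Vh D J"
  shows "(\<lambda>\<rho>. f \<rho> - c) \<in> Vh D J"
proof -
  have "\<exists>a b. \<forall>\<rho>\<in>element J j. f \<rho> - c = a + b * \<rho>" if j: "j \<in> {1..J}" for j
  proof -
    obtain a b where "\<And>\<rho>. \<rho> \<in> element J j \<Longrightarrow> f \<rho> = a + b * \<rho>"
      using Vh_affine[OF assms j] by blast
    then show ?thesis by (intro exI[of _ "a - c"] exI[of _ b]) auto
  qed
  moreover have "continuous_on {0..1} (\<lambda>\<rho>. f \<rho> - c)" "D = Circle \<longrightarrow> f 0 = f 1"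
    using assms by (auto simp: Vh_def intro!: continuous_intros)
  ultimately show ?thesis
    by (simp add: Vh_def)
qed

lemma deriv_rho_minus_const: "deriv_rho (\<lambda>\<rho>. f \<rho> - c) \<rho> = deriv_rho f \<rho>"
  using has_vector_derivative_add_const[of f "- c"]
  by (simp add: deriv_rho_def vector_derivative_def)

text \<open>
  The speed of a discrete curve is constant on the interior of each element. Its value at the
  midpoint serves at the endpoints as well, where the elementwise derivative is unspecified.
\<close>

definition element_speed :: "nat \<Rightarrow> (real \<Rightarrow> real^2) \<Rightarrow> nat \<Rightarrow> real" where
  "element_speed J X j = speed X ((node J (j - 1) + node J j) / 2)"

lemma midpoint_mem_open_element:
  assumes "j \<in> {1..J}"
  shows "(node J (j - 1) + node J j) / 2 \<in> open_element J j"
  using node_mem_unit(2)[OF assms] by (simp add: open_element_def field_simps)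

lemma speed_eq_element_speed:
  assumes "X \<in> Vh_bdry D J" "j \<in> {1..J}" "\<rho> \<in> open_element J j"
  shows "speed X \<rho> = element_speed J X j"
proof -
  obtain A B where AB: "\<And>\<rho>. \<rho> \<in> element J j \<Longrightarrow> X \<rho> = A + \<rho> *\<^sub>R B"
    using Vh_bdry_affine[OF assms(1,2)] by blast
  have "deriv_rho X \<sigma> = B" if "\<sigma> \<in> open_element J j" for \<sigma>
  proof -
    have "((\<lambda>\<rho>. A + \<rho> *\<^sub>R B) has_vector_derivative B) (at \<sigma>)"
      by (auto intro!: derivative_eq_intros)
    then have "(X has_vector_derivative B) (at \<sigma>)"
      by (rule has_vector_derivative_transform_within_open[where S = "open_element J j"])
        (use that AB open_element_subset[of J j] in \<open>auto simp: open_element_def\<close>)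
    then show ?thesis
      by (simp add: deriv_rho_def vector_derivative_at)
  qed
  then show ?thesis
    using assms(3) midpoint_mem_open_element[OF assms(2)]
    by (simp add: speed_def element_speed_def)
qed

lemma element_speed_pos:
  assumes "admissible D J X" "j \<in> {1..J}"
  shows "0 < element_speed J X j"
  using assms midpoint_mem_open_element[OF assms(2)]
  by (auto simp: admissible_def element_speed_def)

lemma admissible_radius_nonneg:
  assumes "admissible D J X" "\<rho> \<in> {0..1}"
  shows "0 \<le> X \<rho> \<bullet> e1"
  using assms by (cases "\<rho> \<in> bdry D") (auto simp: admissible_def Vh_bdry_def intro: less_imp_le)

lemma admissible_radius_pos:
  assumes "admissible D J X" "j \<in> {1..J}" "\<rho> \<in> open_element J j"
  shows "0 < X \<rho> \<bullet> e1"
proof -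
  have "\<rho> \<in> {0<..<1}"
    using node_mem_unit[OF assms(2)] assms(3) by (auto simp: open_element_def)
  then have "\<rho> \<in> {0..1} - bdry D"
    by (cases D) auto
  then show ?thesis
    using assms(1) by (simp add: admissible_def)
qed

lemma has_integral_sum_elements:
  assumes "J \<ge> 1" and "\<And>j. j \<in> {1..J} \<Longrightarrow> (f has_integral I j) (element J j)"
  shows "((f :: real \<Rightarrow> real) has_integral (\<Sum>j=1..J. I j)) {0..1}"
proof -
  have "(f has_integral (\<Sum>j=1..n. I j)) {0..node J n}" if "n \<le> J" for n
    using that
  proof (induction n)
    case 0
    show ?case by (simp add: node_def has_integral_refl(2)[where a = "0::real", simplified])
  next
    case (Suc n)
    then have j: "Suc n \<in> {1..J}" by simp
    have "(f has_integral (\<Sum>j=1..n. I j) + I (Suc n)) {0..node J (Suc n)}"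
      by (rule has_integral_combine[where c = "node J n"])
        (use Suc node_mem_unit[OF j] assms(2)[OF j] in \<open>auto simp: element_def\<close>)
    then show ?case by simp
  qed
  from this[of J] show ?thesis
    using assms(1) by (simp add: node_def mesh_def)
qed

text \<open>
  The energy density is a product of three affine factors and a constant on each element,
  hence a polynomial of degree at most three, which the rule integrates exactly.
\<close>

lemma energy_eq_quadrature:
  assumes "J \<ge> 1" and quad: "quadrature_rule J Q w"
    and X: "X \<in> Vh_bdry D J" and \<mu>: "\<mu> \<in> Vh D J"
  shows "energy c X \<mu> =
    pi * (\<Sum>j=1..J. \<Sum>p\<in>Q j. w j p * ((X p \<bullet> e1) * (\<mu> p - c)\<^sup>2 * element_speed J X j))"
proof -
  let ?f = "\<lambda>\<rho>. (X \<rho> \<bullet> e1) * (\<mu> \<rho> - c)\<^sup>2 * speed X \<rho>"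
  let ?I = "\<lambda>j. \<Sum>p\<in>Q j. w j p * ((X p \<bullet> e1) * (\<mu> p - c)\<^sup>2 * element_speed J X j)"
  have "(?f has_integral ?I j) (element J j)" if j: "j \<in> {1..J}" for j
  proof -
    obtain A B where AB: "\<And>\<rho>. \<rho> \<in> element J j \<Longrightarrow> X \<rho> = A + \<rho> *\<^sub>R B"
      using Vh_bdry_affine[OF X j] by blast
    obtain a b where ab: "\<And>\<rho>. \<rho> \<in> element J j \<Longrightarrow> \<mu> \<rho> = a + b * \<rho>"
      using Vh_affine[OF \<mu> j] by blast
    define q where
      "q = [:A \<bullet> e1, B \<bullet> e1:] * [:a - c, b:]\<^sup>2 * [:element_speed J X j:]"
    have q: "poly q \<rho> = (X \<rho> \<bullet> e1) * (\<mu> \<rho> - c)\<^sup>2 * element_speed J X j"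
      if "\<rho> \<in> element J j" for \<rho>
      by (simp add: q_def AB[OF that] ab[OF that] inner_add_left algebra_simps)
    have "degree q \<le> degree [:A \<bullet> e1, B \<bullet> e1:] + degree ([:a - c, b:]\<^sup>2)
        + degree [:element_speed J X j:]"
      unfolding q_def using degree_mult_le by (meson add_le_mono1 order_trans)
    also have "\<dots> \<le> 1 + 1 * 2 + 0"
      by (intro add_mono order_trans[OF degree_power_le] mult_right_mono) auto
    finally have "degree q \<le> 3" by simp
    then have "(\<Sum>p\<in>Q j. w j p * poly q p) = integral (element J j) (poly q)"
      using quad j by (auto simp: quadrature_rule_def)
    moreover have "(\<Sum>p\<in>Q j. w j p * poly q p) = ?I j"
    proof (intro sum.cong refl)
      fix p assume "p \<in> Q j"
      then have "p \<in> element J j"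
        using quad j unfolding quadrature_rule_def by blast
      then show "w j p * poly q p = w j p * ((X p \<bullet> e1) * (\<mu> p - c)\<^sup>2 * element_speed J X j)"
        by (simp add: q)
    qed
    moreover have "poly q integrable_on element J j"
      unfolding element_def by (intro integrable_continuous_interval continuous_intros)
    ultimately have "(poly q has_integral ?I j) (element J j)"
      by (simp add: has_integral_iff)
    then show ?thesis
      by (rule has_integral_spike_finite[where S = "{node J (j - 1), node J j}", rotated 2])
        (auto simp: q speed_eq_element_speed[OF X j] element_def open_element_def)
  qed
  then have "integral {0..1} ?f = (\<Sum>j=1..J. ?I j)"
    by (intro integral_unique has_integral_sum_elements[OF assms(1)])
  then show ?thesis
    by (simp add: energy_def)
qed

lemma Lim_within_open_element:
  fixes F G :: "real \<Rightarrow> real"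
  assumes j: "j \<in> {1..J}" and p: "p \<in> element J j"
    and F: "continuous_on (element J j) F"
    and eq: "\<And>\<rho>. \<rho> \<in> open_element J j \<Longrightarrow> F \<rho> = G \<rho>"
  shows "Lim (at p within open_element J j) G = F p"
proof (rule tendsto_Lim)
  have "p \<in> closure (open_element J j)"
    using p node_mem_unit(2)[OF j]
    by (simp add: open_element_def element_def closure_greaterThanLessThan)
  moreover have "open (open_element J j)"
    by (simp add: open_element_def)
  ultimately have "p islimpt open_element J j"
    by (metis Un_iff closure_def interior_limit_point interior_open mem_Collect_eq)
  then show "\<not> trivial_limit (at p within open_element J j)"
    by (simp add: trivial_limit_within)
  have "(F \<longlongrightarrow> F p) (at p within element J j)"
    using F p by (simp add: continuous_on_def)
  then have "(F \<longlongrightarrow> F p) (at p within open_element J j)"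
    by (rule tendsto_within_subset[OF _ open_element_subset])
  moreover have "\<forall>\<^sub>F \<rho> in at p within open_element J j. F \<rho> = G \<rho>"
    by (auto simp: eventually_at_filter eq)
  ultimately show "(G \<longlongrightarrow> F p) (at p within open_element J j)"
    by (rule Lim_transform_eventually)
qed

lemma weighted_young:
  fixes A A' a b :: real
  assumes "A \<ge> 0" "A' \<ge> 0"
  shows "A * a\<^sup>2 - A' * b\<^sup>2 \<le> 2 * (A * a\<^sup>2 - sqrt (A * A') * a * b)"
proof -
  have "0 \<le> (sqrt A * a - sqrt A' * b)\<^sup>2"
    by simp
  also have "\<dots> = A * a\<^sup>2 + A' * b\<^sup>2 - 2 * (sqrt (A * A') * a * b)"
    using assms by (simp add: power2_diff power_mult_distrib real_sqrt_mult)
  finally show ?thesis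
    by simp
qed

text \<open>
  With \<open>A = x s\<close> and \<open>A' = x' s'\<close> the weights of the current and the previous curve,
  \<open>A \<surd>jac = \<surd>(A A')\<close>. The right-hand side is free of quotients and continuous up to the endpoints of
  the element, so the limits at quadrature points are plain values even where the
  curve touches the axis and \<open>jac\<close> becomes \<open>0/0\<close>. At each point the estimate is then
  \<open>2 \<surd>(A A') a b \<le> A a\<^sup>2 + A' b\<^sup>2\<close>.
\<close>

lemma diamond_ge_energy_difference:
  assumes "J \<ge> 1" and quad: "quadrature_rule J Q w" and dt: "dt > 0"
    and Xp: "admissible D J Xp" and X: "admissible D J X"
    and \<mu>: "\<mu> \<in> Vh D J" and \<mu>n: "\<mu>n \<in> Vh D J"
  shows "energy c X \<mu>n - energy c Xp \<mu> \<le> 2 * pi * dt * diamond J Q w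
       (\<lambda>\<rho>. (X \<rho> \<bullet> e1) * ((\<mu>n \<rho> - c - (\<mu> \<rho> - c) * sqrt (jac Xp X \<rho>)) / dt))
       (\<lambda>\<rho>. (\<mu>n \<rho> - c) * speed X \<rho>)"
proof -
  let ?G = "\<lambda>\<rho>. ((X \<rho> \<bullet> e1) * ((\<mu>n \<rho> - c - (\<mu> \<rho> - c) * sqrt (jac Xp X \<rho>)) / dt))
      \<bullet> ((\<mu>n \<rho> - c) * speed X \<rho>)"
  let ?A = "\<lambda>j \<rho>. (X \<rho> \<bullet> e1) * element_speed J X j"
  let ?A' = "\<lambda>j \<rho>. (Xp \<rho> \<bullet> e1) * element_speed J Xp j"
  let ?F = "\<lambda>j \<rho>. (?A j \<rho> * (\<mu>n \<rho> - c)\<^sup>2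
      - sqrt (?A j \<rho> * ?A' j \<rho>) * (\<mu>n \<rho> - c) * (\<mu> \<rho> - c)) / dt"
  have XV: "X \<in> Vh_bdry D J" and XpV: "Xp \<in> Vh_bdry D J"
    using X Xp by (auto simp: admissible_def)
  have local: "w j p * (?A j p * (\<mu>n p - c)\<^sup>2) - w j p * (?A' j p * (\<mu> p - c)\<^sup>2)
      \<le> 2 * dt * (w j p * Lim (at p within open_element J j) ?G)"
    if j: "j \<in> {1..J}" and pQ: "p \<in> Q j" for j p
  proof -
    have p: "p \<in> element J j" and w: "w j p \<ge> 0"
      using quad j pQ by (auto simp: quadrature_rule_def)
    have F: "continuous_on (element J j) (?F j)"
    proof -
      have sub: "element J j \<subseteq> {0..1}"
        using element_subset_unit[OF j] by blast
      have "continuous_on {0..1} \<mu>" "continuous_on {0..1} \<mu>n"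
        using \<mu> \<mu>n by (auto simp: Vh_def)
      moreover have "continuous_on (element J j) Y" if Y: "Y \<in> Vh_bdry D J" for Y
      proof -
        obtain A B where "\<And>\<rho>. \<rho> \<in> element J j \<Longrightarrow> Y \<rho> = A + \<rho> *\<^sub>R B"
          using Vh_bdry_affine[OF Y j] by blast
        then show ?thesis
          by (subst continuous_on_cong[OF refl]) (auto intro!: continuous_intros)
      qed
      ultimately show ?thesis
        using XV XpV dt sub
        by (auto intro!: continuous_intros intro: continuous_on_subset)
    qed
    have FG: "?F j \<rho> = ?G \<rho>" if \<rho>: "\<rho> \<in> open_element J j" for \<rho>
    proof -
      have pos: "?A j \<rho> > 0"
        using admissible_radius_pos[OF X j \<rho>] element_speed_pos[OF X j] by simp
      have "?A j \<rho> * sqrt (jac Xp X \<rho>) = sqrt ((?A j \<rho>)\<^sup>2 * jac Xp X \<rho>)"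
        using pos by (simp add: real_sqrt_mult)
      also have "(?A j \<rho>)\<^sup>2 * jac Xp X \<rho> = ?A j \<rho> * ?A' j \<rho>"
        using pos speed_eq_element_speed[OF XV j \<rho>] speed_eq_element_speed[OF XpV j \<rho>]
        by (simp add: jac_def power2_eq_square)
      finally have "sqrt (?A j \<rho> * ?A' j \<rho>) = ?A j \<rho> * sqrt (jac Xp X \<rho>)"
        by simp
      then show ?thesis
        using speed_eq_element_speed[OF XV j \<rho>] dt
        by (simp add: field_simps power2_eq_square)
    qed
    have unit: "p \<in> {0..1}"
      using element_subset_unit[OF j p] .
    have A: "?A j p \<ge> 0" and A': "?A' j p \<ge> 0"
      using admissible_radius_nonneg[OF X unit] element_speed_pos[OF X j]
        admissible_radius_nonneg[OF Xp unit] element_speed_pos[OF Xp j] by simp_all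
    have "?A j p * (\<mu>n p - c)\<^sup>2 - ?A' j p * (\<mu> p - c)\<^sup>2 \<le> 2 * dt * ?F j p"
      using weighted_young[OF A A', of "\<mu>n p - c" "\<mu> p - c"] dt by simp
    then have "w j p * (?A j p * (\<mu>n p - c)\<^sup>2 - ?A' j p * (\<mu> p - c)\<^sup>2)
        \<le> w j p * (2 * dt * ?F j p)"
      using w by (rule mult_left_mono)
    moreover have "Lim (at p within open_element J j) ?G = ?F j p"
      by (rule Lim_within_open_element[OF j p F FG])
    ultimately show ?thesis
      by (simp only: right_diff_distrib mult.left_commute[of "w j p"] mult.assoc)
  qed
  have "energy c X \<mu>n - energy c Xp \<mu> = pi * (\<Sum>j=1..J. \<Sum>p\<in>Q j.
      w j p * (?A j p * (\<mu>n p - c)\<^sup>2) - w j p * (?A' j p * (\<mu> p - c)\<^sup>2))"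
    unfolding energy_eq_quadrature[OF assms(1) quad XV \<mu>n]
      energy_eq_quadrature[OF assms(1) quad XpV \<mu>]
    by (simp add: sum_subtractf right_diff_distrib mult_ac)
  also have "\<dots> \<le> pi * (\<Sum>j=1..J. \<Sum>p\<in>Q j.
      2 * dt * (w j p * Lim (at p within open_element J j) ?G))"
    by (intro mult_left_mono sum_mono local) auto
  also have "\<dots> = 2 * pi * dt * diamond J Q w
       (\<lambda>\<rho>. (X \<rho> \<bullet> e1) * ((\<mu>n \<rho> - c - (\<mu> \<rho> - c) * sqrt (jac Xp X \<rho>)) / dt))
       (\<lambda>\<rho>. (\<mu>n \<rho> - c) * speed X \<rho>)"
    by (simp add: diamond_def sum_distrib_left[symmetric] mult_ac)
  finally show ?thesis .
qed

text \<open>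
  Tested with \<open>Vn\<close> in the first equation and with \<open>\<mu>n - c\<close> in the second, the coupling terms have
  pointwise equal integrands, and the convective integrand is identically zero because \<open>\<mu>n\<close>
  and \<open>\<mu>n - c\<close> have the same derivative.
\<close>

lemma dissipation_eq_diamond:
  assumes "Vn \<in> Vh D J" "\<mu>n \<in> Vh D J"
    and L1: "eq_L1 D J c X \<mu> \<kappa> Vn \<mu>n"
    and L2: "eq_L2 D J Q w c dt Xp X \<mu> \<kappa> Vn \<mu>n"
  shows "ip (\<lambda>\<rho>. (X \<rho> \<bullet> e1) * (Vn \<rho>)\<^sup>2) (speed X) = - diamond J Q w
       (\<lambda>\<rho>. (X \<rho> \<bullet> e1) * ((\<mu>n \<rho> - c - (\<mu> \<rho> - c) * sqrt (jac Xp X \<rho>)) / dt))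
       (\<lambda>\<rho>. (\<mu>n \<rho> - c) * speed X \<rho>)"
proof -
  note E1 = L1[unfolded eq_L1_def, rule_format, OF assms(1)]
  note E2 = L2[unfolded eq_L2_def, rule_format, OF Vh_minus_const[OF assms(2), of c]]
  have dissipation: "ip (\<lambda>\<rho>. (X \<rho> \<bullet> e1) * Vn \<rho>) (\<lambda>\<rho>. Vn \<rho> * speed X \<rho>) =
      ip (\<lambda>\<rho>. (X \<rho> \<bullet> e1) * (Vn \<rho>)\<^sup>2) (speed X)"
    by (simp add: ip_def power2_eq_square mult_ac)
  have gradient: "ip (\<lambda>\<rho>. (X \<rho> \<bullet> e1) * deriv_rho \<mu>n \<rho>)
        (\<lambda>\<rho>. deriv_rho Vn \<rho> * inverse (speed X \<rho>)) =
      ip (\<lambda>\<rho>. (X \<rho> \<bullet> e1) * deriv_rho Vn \<rho>)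
        (\<lambda>\<rho>. deriv_rho (\<lambda>\<rho>. \<mu>n \<rho> - c) \<rho> * inverse (speed X \<rho>))"
    by (simp add: ip_def deriv_rho_minus_const mult_ac)
  have normal: "ip (\<lambda>\<rho>. (normal_vec X \<rho> \<bullet> e1) * \<kappa> \<rho> * (\<mu>n \<rho> - c)) (\<lambda>\<rho>. Vn \<rho> * speed X \<rho>) =
      ip (\<lambda>\<rho>. (normal_vec X \<rho> \<bullet> e1) * \<kappa> \<rho> * Vn \<rho>) (\<lambda>\<rho>. (\<mu>n \<rho> - c) * speed X \<rho>)"
    by (simp add: ip_def mult_ac)
  have curvature: "ip (\<lambda>\<rho>. (X \<rho> \<bullet> e1) * (\<mu> \<rho> + c) * \<mu> \<rho> * (\<mu>n \<rho> - c)) (\<lambda>\<rho>. Vn \<rho> * speed X \<rho>) =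
      ip (\<lambda>\<rho>. (X \<rho> \<bullet> e1) * (\<mu> \<rho> + c) * \<mu> \<rho> * Vn \<rho>) (\<lambda>\<rho>. (\<mu>n \<rho> - c) * speed X \<rho>)"
    by (simp add: ip_def mult_ac)
  have convection: "ip (\<lambda>\<rho>. (X \<rho> \<bullet> e1) * (((X \<rho> - Xp \<rho>) \<bullet> tangent X \<rho>) / dt))
      (\<lambda>\<rho>. deriv_rho \<mu>n \<rho> * (\<mu>n \<rho> - c)
        - (\<mu>n \<rho> - c) * deriv_rho (\<lambda>\<rho>. \<mu>n \<rho> - c) \<rho>) = 0"
    by (simp add: ip_def deriv_rho_minus_const mult.commute)
  show ?thesis
    using E1 E2 unfolding dissipation gradient normal curvature convection by linarith
qed

theorem theorem4p3:
  fixes D :: domain and J M m :: nat and T c dt :: real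
    and Q :: "nat \<Rightarrow> real set" and w :: "nat \<Rightarrow> real \<Rightarrow> real"
    and X :: "nat \<Rightarrow> real \<Rightarrow> real^2"
    and V \<mu> \<kappa> :: "nat \<Rightarrow> real \<Rightarrow> real"
  assumes "J \<ge> 1" and "T > 0" and "dt = T / real M"
    and "quadrature_rule J Q w"
    and "\<And>k. k \<le> M \<Longrightarrow> admissible D J (X k)"
    and "m < M"
    and "\<mu> m \<in> Vh D J" and "\<kappa> m \<in> Vh D J"
    and "solves_step D J Q w c dt (prev X m) (X m) (\<mu> m) (\<kappa> m)
           (V (Suc m)) (\<mu> (Suc m)) (\<kappa> (Suc m)) (X (Suc m))"
  shows "energy c (X m) (\<mu> (Suc m))
           + 2 * pi * dt * ip (\<lambda>\<rho>. (X m \<rho> \<bullet> e1) * (V (Suc m) \<rho>)\<^sup>2) (speed (X m))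
         \<le> energy c (prev X m) (\<mu> m)"
proof -
  let ?A = "diamond J Q w
       (\<lambda>\<rho>. (X m \<rho> \<bullet> e1) *
         ((\<mu> (Suc m) \<rho> - c - (\<mu> m \<rho> - c) * sqrt (jac (prev X m) (X m) \<rho>)) / dt))
       (\<lambda>\<rho>. (\<mu> (Suc m) \<rho> - c) * speed (X m) \<rho>)"
  have dt: "dt > 0"
    using assms(2,3,6) by simp
  have "admissible D J (prev X m)" "admissible D J (X m)"
    using assms(5,6) by (auto simp: prev_def)
  moreover have step: "V (Suc m) \<in> Vh D J" "\<mu> (Suc m) \<in> Vh D J"
      "eq_L1 D J c (X m) (\<mu> m) (\<kappa> m) (V (Suc m)) (\<mu> (Suc m))"
      "eq_L2 D J Q w c dt (prev X m) (X m) (\<mu> m) (\<kappa> m) (V (Suc m)) (\<mu> (Suc m))"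
    using assms(9) by (auto simp: solves_step_def)
  ultimately have "energy c (X m) (\<mu> (Suc m)) - energy c (prev X m) (\<mu> m) \<le> 2 * pi * dt * ?A"
    using diamond_ge_energy_difference[OF assms(1,4) dt] assms(7) by blast
  then show ?thesis
    unfolding dissipation_eq_diamond[OF step] by simp
qed

end
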